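(* Let $\|\cdot\|$ be a norm on $\mathbb{R}^2$ with closed unit ball $B=\{x\in\mathbb{R}^2:\|x\|\le 1\}$. Let $n\ge 5$ be an integer, let $v_1,v_2,\ldots,v_n\in B$ be vectors, not necessarily distinct, write $V=\{v_1,\ldots,v_n\}$, and let $k\in\{1,\ldots,n\}$ be odd with $k>3$. If every $3$-sum of $V$ lies outside $B$, then every $k$-sum of $V$ lies outside $B$.
   Context: The norm on $\mathbb{R}^2$ is arbitrary. The family $V=\{v_1,\ldots,v_n\}$ is regarded as a sequence (multiset): $v_i=v_j$ is allowed for $i\ne j$. For a positive integer $m\le n$, an $m$-sum of $V$ is a vector of the form $\sum_{i\in S}v_i$ where $S$ is an $m$-element subset of the index set $\{1,\ldots,n\}$. *)

theory Defs
  imports "HOL-Analysis.Analysis"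
begin

(* The library's norm on real^2 is the Euclidean one, so an arbitrary norm is
   modelled as a function satisfying the norm axioms. *)
definition is_norm :: "('a::real_vector \<Rightarrow> real) \<Rightarrow> bool" where
  "is_norm N \<longleftrightarrow>
     (\<forall>x. 0 \<le> N x) \<and>
     (\<forall>x. N x = 0 \<longleftrightarrow> x = 0) \<and>
     (\<forall>c x. N (c *\<^sub>R x) = \<bar>c\<bar> * N x) \<and>
     (\<forall>x y. N (x + y) \<le> N x + N y)"

definition unit_ball :: "('a::real_vector \<Rightarrow> real) \<Rightarrow> 'a set" where
  "unit_ball N = {x. N x \<le> 1}"

(* The family v_1, ..., v_n is a sequence of which only the values at 1, ..., n
   matter; S ranges over sets of indices, so repeated vectors count separately. *)
definition m_sums :: "nat \<Rightarrow> (nat \<Rightarrow> 'a::real_vector) \<Rightarrow> nat \<Rightarrow> 'a set" where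
  "m_sums n v m = {(\<Sum>i\<in>S. v i) | S. S \<subseteq> {1..n} \<and> card S = m}"

end

theory Submission
  imports Defs
begin

text \<open>
  The contrapositive is what gets proved: if an odd number of vectors of the unit ball \<open>B\<close> of a
  planar norm, at least three of them, have their sum in \<open>B\<close>, then some three of them have their
  sum in \<open>B\<close>.

  Adjoin the negated total to the given vectors. This produces a family \<open>w\<close> in \<open>B\<close> with sum
  \<open>0\<close>, and it suffices to find three members of \<open>w\<close> whose sum lies in \<open>B\<close>
  (\<open>triple_in_ball_of_zero_sum\<close>). If the adjoined vector is not among them, they are the required
  triple. If it is, then the negative of their sum is the sum of all given vectors but two; the
  number of vectors stays odd, so this descent (\<open>triple_or_pair_removal_in_ball\<close>) can only end at a triple.

  For the zero-sum family, look at the linear relations with coefficients in \<open>[0, 1]\<close> of total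
  \<open>2\<close>; constant coefficients give one. Passing to a vertex of the polytope of all these relations
  leaves at most four nonzero coefficients (\<open>balanced_relation_small_support\<close>). Inside four vectors
  there is still a line of relations of total \<open>2\<close>, since four points of the plane are affinely
  dependent. Move along it so that the largest coefficient does not grow, until either some
  coefficient vanishes or the largest one is attained twice. Both situations exhibit a triple
  (\<open>triple_of_four_relation\<close>):

  \<^item> If \<open>x f + y b + z c = 0\<close> with \<open>y, z \<le> x \<le> y + z\<close>, eliminating \<open>f\<close> gives
    \<open>f + b + c = (1 - y/x) b + (1 - z/x) c\<close>, of norm at most \<open>2 - (y + z)/x \<le> 1\<close>. The
    bound \<open>x \<le> y + z\<close> is where the total \<open>2\<close> enters: no coefficient exceeds half of it.

  \<^item> If \<open>x f + x a + y b + z c = 0\<close> with \<open>z \<le> y \<le> x\<close>, eliminating \<open>f + a\<close> gives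
    \<open>f + a + b = (1 - y/x) b - (z/x) c\<close>, of norm at most \<open>1 - (y - z)/x \<le> 1\<close>.
\<close>

section \<open>Triples in the ball read off from linear relations\<close>

lemma is_norm_lincomb2_le:
  assumes "is_norm N" "N x \<le> 1" "N y \<le> 1"
  shows "N (a *\<^sub>R x + b *\<^sub>R y) \<le> \<bar>a\<bar> + \<bar>b\<bar>"
proof -
  have "N (a *\<^sub>R x + b *\<^sub>R y) \<le> \<bar>a\<bar> * N x + \<bar>b\<bar> * N y"
    using assms(1) unfolding is_norm_def by metis
  also have "\<dots> \<le> \<bar>a\<bar> * 1 + \<bar>b\<bar> * 1"
    using assms(2,3) by (intro add_mono mult_left_mono) auto
  finally show ?thesis by simp
qed

lemma is_norm_minus: "is_norm N \<Longrightarrow> N (- x) = N x"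
  unfolding is_norm_def by (metis abs_minus_cancel abs_one mult_1 scaleR_minus_left scaleR_one)

lemma sum_in_ball_of_triangle_relation:
  assumes N: "is_norm N" and "N b \<le> 1" "N c \<le> 1"
    and rel: "x *\<^sub>R f + y *\<^sub>R b + z *\<^sub>R c = 0"
    and "0 \<le> y" "0 \<le> z" "y \<le> x" "z \<le> x" "x \<le> y + z" "0 < x"
  shows "N (f + b + c) \<le> 1"
proof -
  have "f = (1 / x) *\<^sub>R (x *\<^sub>R f)" using \<open>0 < x\<close> by simp
  also have "x *\<^sub>R f = - (y *\<^sub>R b) - z *\<^sub>R c"
    using rel minus_unique[of "y *\<^sub>R b + z *\<^sub>R c" "x *\<^sub>R f"] by (simp add: algebra_simps)
  finally have f: "f = (1 / x) *\<^sub>R (- (y *\<^sub>R b) - z *\<^sub>R c)" .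
  have "f + b + c = (1 - y / x) *\<^sub>R b + (1 - z / x) *\<^sub>R c"
    by (subst f) (simp add: algebra_simps)
  then have "N (f + b + c) \<le> \<bar>1 - y / x\<bar> + \<bar>1 - z / x\<bar>"
    using is_norm_lincomb2_le[OF N] assms by metis
  also have "\<dots> = 2 - (y + z) / x" using assms by (simp add: abs_if field_simps)
  also have "\<dots> \<le> 1" using assms by (simp add: field_simps)
  finally show ?thesis .
qed

lemma sum_in_ball_of_tied_relation:
  assumes N: "is_norm N" and "N b \<le> 1" "N c \<le> 1"
    and rel: "x *\<^sub>R f + x *\<^sub>R a + y *\<^sub>R b + z *\<^sub>R c = 0"
    and "0 \<le> z" "z \<le> y" "y \<le> x" "0 < x"
  shows "N (f + a + b) \<le> 1"
proof -
  have "f + a = (1 / x) *\<^sub>R (x *\<^sub>R f + x *\<^sub>R a)" 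
    using \<open>0 < x\<close> by (simp add: algebra_simps)
  also have "x *\<^sub>R f + x *\<^sub>R a = - (y *\<^sub>R b) - z *\<^sub>R c"
    using rel minus_unique[of "y *\<^sub>R b + z *\<^sub>R c" "x *\<^sub>R f + x *\<^sub>R a"]
    by (simp add: algebra_simps)
  finally have fa: "f + a = (1 / x) *\<^sub>R (- (y *\<^sub>R b) - z *\<^sub>R c)" .
  have "f + a + b = (1 - y / x) *\<^sub>R b + (- (z / x)) *\<^sub>R c"
    by (subst fa) (simp add: algebra_simps)
  then have "N (f + a + b) \<le> \<bar>1 - y / x\<bar> + \<bar>- (z / x)\<bar>"
    using is_norm_lincomb2_le[OF N] assms by metis
  also have "\<dots> = 1 - (y - z) / x" using assms by (simp add: abs_if field_simps)
  also have "\<dots> \<le> 1" using assms by (simp add: field_simps)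
  finally show ?thesis .
qed

section \<open>Moving along affine dependences\<close>

text \<open>
  A ray that starts in a polyhedron given by finitely many inequalities, and along which one of the
  slacks \<open>c j\<close> decreases, leaves through a point where some inequality is tight. The exit time is
  the smallest of the ratios \<open>c j / - e j\<close> over the decreasing slacks.
\<close>

lemma first_hitting_time:
  fixes c e :: "'j \<Rightarrow> real"
  assumes "finite J" "\<forall>j\<in>J. 0 \<le> c j" "\<exists>j\<in>J. e j < 0"
  shows "\<exists>t\<ge>0. (\<forall>i\<in>J. 0 \<le> c i + t * e i) \<and> (\<exists>j\<in>J. c j + t * e j = 0)"
proof -
  let ?K = "{j\<in>J. e j < 0}"
  have K: "finite ?K" "?K \<noteq> {}" using assms by auto
  define j where "j = arg_min_on (\<lambda>i. c i / - e i) ?K"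
  have j: "j \<in> ?K" and "\<not> (\<exists>i\<in>?K. c i / - e i < c j / - e j)"
    unfolding j_def by (fact arg_min_if_finite[OF K])+
  then have min: "\<And>i. i \<in> ?K \<Longrightarrow> c j / - e j \<le> c i / - e i" by (meson not_le_imp_less)
  have t0: "0 \<le> c j / - e j" using j assms(2) by (intro divide_nonneg_pos) auto
  have "0 \<le> c i + c j / - e j * e i" if "i \<in> J" for i
  proof (cases "e i < 0")
    case True
    then have "c j / - e j * - e i \<le> c i"
      using min[of i] that by (simp add: pos_le_divide_eq[of "- e i"] del: divide_minus_right)
    then show ?thesis by simp
  next
    case False
    then have "0 \<le> c j / - e j * e i" using t0 by (intro mult_nonneg_nonneg) auto
    then show ?thesis using assms(2) that by force
  qed
  moreover have "j \<in> J" "c j + c j / - e j * e j = 0" using j by auto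
  ultimately show ?thesis using t0 by blast
qed

text \<open>
  Affine dependence of an indexed family. A repeated vector is a dependence by itself, whereas the
  set of values does not see the repetition; hence the case distinction on injectivity.
\<close>

lemma exists_affine_dependence:
  fixes w :: "'i \<Rightarrow> 'a::euclidean_space"
  assumes "finite J" "card J > DIM('a) + 1"
  obtains d where "sum d J = 0" "(\<Sum>j\<in>J. d j *\<^sub>R w j) = 0" "\<exists>j\<in>J. d j \<noteq> 0"
proof (cases "inj_on w J")
  case True
  let ?P = "w ` J"
  have "affine_dependent ?P"
    using assms True by (intro affine_dependent_biggerset) (auto simp: card_image)
  then obtain u where u: "sum u ?P = 0" "\<exists>x\<in>?P. u x \<noteq> 0" "(\<Sum>x\<in>?P. u x *\<^sub>R x) = 0"
    using assms(1) affine_dependent_explicit_finite[of ?P] by auto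
  show ?thesis
    by (rule that[of "u \<circ> w"]) (use u True in \<open>auto simp: sum.reindex\<close>)
next
  case False
  then obtain i j where ij: "i \<in> J" "j \<in> J" "i \<noteq> j" "w i = w j" by (auto simp: inj_on_def)
  let ?d = "\<lambda>l. (if l = i then 1 else 0) - (if l = j then 1 else 0) :: real"
  show ?thesis
  proof (rule that[of ?d])
    show "sum ?d J = 0" using ij assms by (simp add: sum_subtractf)
    have "(\<Sum>l\<in>J. ?d l *\<^sub>R w l) = (\<Sum>l\<in>J. if l = i then w l else 0) - (\<Sum>l\<in>J. if l = j then w l else 0)"
      unfolding sum_subtractf[symmetric] by (intro sum.cong) auto
    then show "(\<Sum>l\<in>J. ?d l *\<^sub>R w l) = 0" using ij assms by simp
    show "\<exists>l\<in>J. ?d l \<noteq> 0" using ij by (intro bexI[of _ i]) auto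
  qed
qed

section \<open>Balanced relations with few nonzero coefficients\<close>

text \<open>
  Up to scaling, these are the nontrivial nonnegative relations in which no coefficient exceeds the
  sum of the others. Fixing the total to \<open>2\<close> makes this condition the box constraint \<open>l i \<le> 1\<close>, so
  that they form a polytope.
\<close>

definition balanced_relation :: "'i set \<Rightarrow> ('i \<Rightarrow> 'a::real_vector) \<Rightarrow> ('i \<Rightarrow> real) \<Rightarrow> bool" where
  "balanced_relation I w l \<longleftrightarrow>
     (\<forall>i\<in>I. 0 \<le> l i \<and> l i \<le> 1) \<and> sum l I = 2 \<and> (\<Sum>i\<in>I. l i *\<^sub>R w i) = 0"

text \<open>
  The step from a non-vertex of the polytope to a smaller face: more than \<open>d + 1\<close> vectors of
  \<open>\<real>\<^sup>d\<close> are affinely dependent, and changing the fractional weights along a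
  dependence preserves both the total and the relation. Weights \<open>0\<close> and \<open>1\<close> stay put, so the first
  weight to reach an end of \<open>[0, 1]\<close> lowers the number of fractional ones.
\<close>

lemma fewer_fractional_weights:
  fixes w :: "'i \<Rightarrow> 'a::euclidean_space"
  assumes I: "finite I" and bal: "balanced_relation I w l"
    and many: "card {i\<in>I. 0 < l i \<and> l i < 1} > DIM('a) + 1"
  obtains l' where "balanced_relation I w l'"
    "card {i\<in>I. 0 < l' i \<and> l' i < 1} < card {i\<in>I. 0 < l i \<and> l i < 1}"
proof -
  let ?F = "{i\<in>I. 0 < l i \<and> l i < 1}"
  have F: "finite ?F" "?F \<subseteq> I" using I by auto
  obtain d where d: "sum d ?F = 0" "(\<Sum>j\<in>?F. d j *\<^sub>R w j) = 0" "\<exists>j\<in>?F. d j \<noteq> 0"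
    using exists_affine_dependence[OF F(1) many] by blast
  define e where "e i = (if i \<in> ?F then d i else 0)" for i
  have e: "sum e I = 0" "(\<Sum>i\<in>I. e i *\<^sub>R w i) = 0"
  proof -
    have "sum e I = sum e ?F"
      by (rule sum.mono_neutral_right[OF I F(2)]) (auto simp: e_def)
    then show "sum e I = 0" using d(1) by (simp add: e_def)
    have "(\<Sum>i\<in>I. e i *\<^sub>R w i) = (\<Sum>i\<in>?F. e i *\<^sub>R w i)"
      by (rule sum.mono_neutral_right[OF I F(2)]) (auto simp: e_def)
    then show "(\<Sum>i\<in>I. e i *\<^sub>R w i) = 0" using d(2) by (simp add: e_def)
  qed
  \<comment> \<open>Slack and speed of the constraints \<open>l i \<le> 1\<close> (\<open>up\<close>) and \<open>0 \<le> l i\<close> (not \<open>up\<close>).\<close>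
  let ?c = "\<lambda>(i, up). if up then 1 - l i else l i"
  let ?e = "\<lambda>(i, up). if up then - e i else e i"
  obtain j where "j \<in> ?F" "d j \<noteq> 0" using d by blast
  then have "(j, 0 < d j) \<in> ?F \<times> UNIV" "?e (j, 0 < d j) < 0" by (auto simp: e_def)
  then have ex: "\<exists>p \<in> ?F \<times> UNIV. ?e p < 0" by blast
  have fin: "finite (?F \<times> (UNIV :: bool set))" using F(1) by simp
  have c0: "\<forall>p\<in>?F \<times> UNIV. 0 \<le> ?c p" by (auto split: if_splits)
  obtain t p where "0 \<le> t" and t: "\<And>q. q \<in> ?F \<times> UNIV \<Longrightarrow> 0 \<le> ?c q + t * ?e q"
    and p: "p \<in> ?F \<times> UNIV" "?c p + t * ?e p = 0"
    using first_hitting_time[of _ ?c ?e, OF fin c0 ex] by blast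
  define l' where "l' i = l i + t * e i" for i
  have bnd: "0 \<le> l' i \<and> l' i \<le> 1" if "i \<in> I" for i
  proof (cases "i \<in> ?F")
    case True
    then show ?thesis using t[of "(i, False)"] t[of "(i, True)"] by (simp add: l'_def)
  next
    case False
    then have "l' i = l i" by (simp only: l'_def e_def if_False)
    then show ?thesis using bal that by (simp add: balanced_relation_def)
  qed
  have "sum l' I = sum l I + t * sum e I"
    by (simp add: l'_def sum.distrib sum_distrib_left)
  moreover have "(\<Sum>i\<in>I. l' i *\<^sub>R w i) = (\<Sum>i\<in>I. l i *\<^sub>R w i) + t *\<^sub>R (\<Sum>i\<in>I. e i *\<^sub>R w i)"
    by (simp add: l'_def sum.distrib scaleR_sum_right scaleR_add_left)
  ultimately have bal': "balanced_relation I w l'"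
    using bnd bal e by (simp add: balanced_relation_def)
  have "fst p \<in> ?F" using p(1) by auto
  moreover have "l' (fst p) = 0 \<or> l' (fst p) = 1"
    using p(2) by (auto simp: l'_def split: prod.splits if_splits)
  moreover have "l' i = l i" if "i \<notin> ?F" for i using that by (simp only: l'_def e_def if_False)
  then have "{i\<in>I. 0 < l' i \<and> l' i < 1} \<subseteq> ?F" by force
  ultimately have "{i\<in>I. 0 < l' i \<and> l' i < 1} \<subset> ?F" by force
  then show ?thesis using that[OF bal'] psubset_card_mono[OF F(1)] by blast
qed

text \<open>
  A vertex has at most \<open>d + 1\<close> fractional weights, and the total \<open>2\<close> allows a single weight \<open>1\<close>
  next to them: two weights \<open>1\<close> use up the total, and then nothing else is nonzero.
\<close>

lemma balanced_relation_small_support: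
  fixes w :: "'i \<Rightarrow> 'a::euclidean_space"
  assumes I: "finite I" and bal: "balanced_relation I w l"
  obtains l' where "balanced_relation I w l'" "card {i\<in>I. l' i \<noteq> 0} \<le> DIM('a) + 2"
proof -
  let ?fr = "\<lambda>l. {i\<in>I. 0 < l i \<and> l i < 1}"
  obtain l' where l': "balanced_relation I w l'"
    and min: "\<And>k. balanced_relation I w k \<Longrightarrow> card (?fr l') \<le> card (?fr k)"
    using ex_has_least_nat[of "balanced_relation I w" l "\<lambda>k. card (?fr k)"] bal by blast
  have le: "card (?fr l') \<le> DIM('a) + 1"
  proof (rule ccontr)
    assume "\<not> ?thesis"
    then have "card (?fr l') > DIM('a) + 1" by simp
    then obtain k where "balanced_relation I w k" "card (?fr k) < card (?fr l')"
      by (rule fewer_fractional_weights[OF I l'])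
    then show False using min[of k] by simp
  qed
  let ?one = "{i\<in>I. l' i = 1}"
  have b: "\<And>i. i \<in> I \<Longrightarrow> 0 \<le> l' i \<and> l' i \<le> 1" "sum l' I = 2" 
    using l' by (auto simp: balanced_relation_def)
  have supp: "{i\<in>I. l' i \<noteq> 0} = ?fr l' \<union> ?one" using b(1) by force
  have "card {i\<in>I. l' i \<noteq> 0} \<le> DIM('a) + 2"
  proof (cases "card ?one \<le> 1")
    case True
    then show ?thesis using le card_Un_le[of "?fr l'" ?one] unfolding supp by linarith
  next
    case False
    have s: "sum l' ?one = real (card ?one)" by simp
    have "?fr l' = {}"
    proof (rule ccontr)
      assume "?fr l' \<noteq> {}"
      then have "0 < sum l' (?fr l')" using I by (intro sum_pos) auto
      moreover have "sum l' (?fr l') + sum l' ?one = sum l' (?fr l' \<union> ?one)"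
        using I by (subst sum.union_disjoint) auto
      moreover have "sum l' (?fr l' \<union> ?one) \<le> sum l' I"
        using I b(1) by (intro sum_mono2) auto
      ultimately show False using s b(2) False by simp
    qed
    moreover have "sum l' ?one \<le> 2"
      using I b by (subst b(2)[symmetric], intro sum_mono2) auto
    ultimately show ?thesis unfolding supp s by (simp only: Un_empty_left)
  qed
  then show ?thesis using that l' by blast
qed

section \<open>Four vectors, and the zero-sum theorem\<close>

lemma four_set_containing_pair:
  assumes "card J = 4" "f \<in> J" "g \<in> J" "f \<noteq> g"
  obtains b c where "J = {f, g, b, c}" "distinct [f, g, b, c]"
proof -
  have "finite J" using assms(1) by (simp add: card_ge_0_finite)
  then have "card (J - {f, g}) = 2" using assms by (simp add: card_Diff_subset)
  then obtain b c where "J - {f, g} = {b, c}" "b \<noteq> c" by (meson card_2_iff)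
  moreover from this have "J = {f, g, b, c}" "f \<notin> {b, c}" "g \<notin> {b, c}" using assms by blast+
  ultimately show ?thesis using that[of b c] assms(4) by auto
qed

text \<open>
  The sign of the dependence \<open>d\<close> is chosen so that the largest weight \<open>l f\<close> does not grow; then
  the box constraint holds along the whole ray as long as \<open>f\<close> stays the largest. The ray
  cannot be endless, because \<open>d\<close> has total \<open>0\<close> and so some weight decreases. It stops at a
  vanishing weight or at a tie with \<open>f\<close>, and each of these places three vectors in the reach of one
  of the two norm estimates.
\<close>

lemma triple_of_four_relation:
  fixes w :: "'i \<Rightarrow> 'a::euclidean_space"
  assumes dim: "DIM('a) = 2" and N: "is_norm N"
    and J: "card J = 4" and ball: "\<And>i. i \<in> J \<Longrightarrow> N (w i) \<le> 1"
    and bal: "balanced_relation J w l"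
  obtains S where "S \<subseteq> J" "card S = 3" "N (sum w S) \<le> 1"
proof -
  have fin: "finite J" "J \<noteq> {}" using J by (auto simp: card_ge_0_finite)
  have "Max (l ` J) \<in> l ` J" using fin by simp
  then obtain f where f: "f \<in> J" and "l f = Max (l ` J)" by force
  then have fmax: "\<And>i. i \<in> J \<Longrightarrow> l i \<le> l f" using fin(1) by simp
  obtain d where "sum d J = 0" "(\<Sum>j\<in>J. d j *\<^sub>R w j) = 0" "\<exists>j\<in>J. d j \<noteq> 0" "d f \<le> 0"
  proof -
    obtain d where d: "sum d J = 0" "(\<Sum>j\<in>J. d j *\<^sub>R w j) = 0" "\<exists>j\<in>J. d j \<noteq> 0"
      using exists_affine_dependence[OF fin(1), of w] J dim by auto
    show ?thesis
    proof (cases "d f \<le> 0")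
      case True
      then show ?thesis using that d by blast
    next
      case False
      then show ?thesis using that[of "\<lambda>j. - d j"] d by (simp add: sum_negf)
    qed
  qed
  note d = this
  have neg: "\<exists>j\<in>J. d j < 0"
  proof (rule ccontr)
    assume "\<not> ?thesis"
    then have "\<And>j. j \<in> J \<Longrightarrow> 0 \<le> d j" by force
    then have "\<forall>j\<in>J. d j = 0" using d(1) sum_nonneg_eq_0_iff[OF fin(1)] by blast
    then show False using d(3) by blast
  qed
  \<comment> \<open>Constraints of the ray: the gap \<open>l f - l j\<close> stays nonnegative (\<open>tie\<close>), and so does \<open>l j\<close>.\<close>
  let ?K = "J \<times> {False} \<union> (J - {f}) \<times> {True}"
  let ?c = "\<lambda>(j, tie). if tie then l f - l j else l j"
  let ?e = "\<lambda>(j, tie). if tie then d f - d j else d j"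
  have c0: "\<forall>p\<in>?K. 0 \<le> ?c p"
    using bal fmax by (auto simp: balanced_relation_def)
  have ex: "\<exists>p\<in>?K. ?e p < 0" using neg by force
  have fin_K: "finite ?K" using fin(1) by simp
  obtain t where t0: "0 \<le> t" and t: "\<forall>q\<in>?K. 0 \<le> ?c q + t * ?e q"
    and hit: "\<exists>p\<in>?K. ?c p + t * ?e p = 0"
    using first_hitting_time[of _ ?c ?e, OF fin_K c0 ex] by (elim exE conjE) (rule that)
  from hit obtain p where p: "p \<in> ?K" "?c p + t * ?e p = 0" by (elim bexE) (rule that)
  define m where "m i = l i + t * d i" for i
  have m0: "0 \<le> m i" if "i \<in> J" for i
    using bspec[OF t, of "(i, False)"] that by (simp add: m_def)
  have mf: "m i \<le> m f" if "i \<in> J" for i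
    using bspec[OF t, of "(i, True)"] that by (cases "i = f") (auto simp: m_def algebra_simps)
  have "m f \<le> l f" using t0 d(4) by (simp add: m_def mult_nonneg_nonpos)
  then have mf1: "m f \<le> 1" using bal f by (auto simp: balanced_relation_def)
  have "sum m J = sum l J + t * sum d J"
    by (simp add: m_def sum.distrib sum_distrib_left)
  then have msum: "sum m J = 2" using d bal by (simp add: balanced_relation_def)
  have "(\<Sum>i\<in>J. m i *\<^sub>R w i) = (\<Sum>i\<in>J. l i *\<^sub>R w i) + t *\<^sub>R (\<Sum>i\<in>J. d i *\<^sub>R w i)"
    by (simp add: m_def sum.distrib scaleR_sum_right scaleR_add_left)
  then have mrel: "(\<Sum>i\<in>J. m i *\<^sub>R w i) = 0" using d bal by (simp add: balanced_relation_def)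
  have "sum m J \<le> (\<Sum>i\<in>J. m f)" by (intro sum_mono mf)
  then have fpos: "0 < m f" using msum J by simp
  \<comment> \<open>The vanishing weight is not that of \<open>f\<close>, which as the largest of total \<open>2\<close> is positive.\<close>
  obtain g tie where p_eq: "p = (g, tie)" by force
  have "g \<in> J" "g \<noteq> f" "m g = 0 \<or> m g = m f"
  proof -
    show "g \<in> J" using p(1) p_eq by auto
    show "m g = 0 \<or> m g = m f" using p(2) p_eq by (auto simp: m_def algebra_simps split: if_splits)
    show "g \<noteq> f" using p fpos p_eq by (auto simp: m_def split: if_splits)
  qed
  then obtain b c where J_eq: "J = {f, g, b, c}" and dist: "distinct [f, g, b, c]"
    using four_set_containing_pair[OF J f] by metis
  have rel4: "m f *\<^sub>R w f + m g *\<^sub>R w g + m b *\<^sub>R w b + m c *\<^sub>R w c = 0"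
    using mrel dist unfolding J_eq by (simp add: add.assoc)
  have sum4: "m f + m g + m b + m c = 2"
    using msum dist unfolding J_eq by (simp add: add.assoc)
  from \<open>m g = 0 \<or> m g = m f\<close> show ?thesis
  proof
    assume "m g = 0"
    then have "N (w f + w b + w c) \<le> 1"
      using rel4 sum4 mf1 m0 mf fpos ball unfolding J_eq
      by (intro sum_in_ball_of_triangle_relation[OF N, of _ _ "m f" _ "m b" "m c"]) auto
    then show ?thesis using dist J_eq by (intro that[of "{f, b, c}"]) (auto simp: add.assoc)
  next
    assume tie: "m g = m f"
    show ?thesis
    proof (cases "m c \<le> m b")
      case True
      then have "N (w f + w g + w b) \<le> 1"
        using rel4 tie m0 mf fpos ball unfolding J_eq
        by (intro sum_in_ball_of_tied_relation[OF N, of _ "w c" "m f" _ _ "m b" "m c"]) auto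
      then show ?thesis using dist J_eq by (intro that[of "{f, g, b}"]) (auto simp: add.assoc)
    next
      case False
      have "m f *\<^sub>R w f + m f *\<^sub>R w g + m c *\<^sub>R w c + m b *\<^sub>R w b = 0"
        using rel4 tie by (simp add: algebra_simps)
      then have "N (w f + w g + w c) \<le> 1"
        using False m0 mf fpos ball unfolding J_eq
        by (intro sum_in_ball_of_tied_relation[OF N, of _ "w b" "m f" _ _ "m c" "m b"]) auto
      then show ?thesis using dist J_eq by (intro that[of "{f, g, c}"]) (auto simp: add.assoc)
    qed
  qed
qed

lemma triple_in_ball_of_zero_sum:
  fixes w :: "'i \<Rightarrow> 'a::euclidean_space"
  assumes dim: "DIM('a) = 2" and N: "is_norm N"
    and I: "finite I" "card I \<ge> 4" and ball: "\<And>i. i \<in> I \<Longrightarrow> N (w i) \<le> 1"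
    and zero: "sum w I = 0"
  obtains S where "S \<subseteq> I" "card S = 3" "N (sum w S) \<le> 1"
proof -
  have "balanced_relation I w (\<lambda>_. 2 / card I)"
    using I zero by (auto simp: balanced_relation_def scaleR_sum_right[symmetric])
  then obtain l where l: "balanced_relation I w l" "card {i\<in>I. l i \<noteq> 0} \<le> DIM('a) + 2"
    by (rule balanced_relation_small_support[OF I(1)])
  then have "card {i\<in>I. l i \<noteq> 0} \<le> 4" using dim by simp
  then obtain J where J: "{i\<in>I. l i \<noteq> 0} \<subseteq> J" "J \<subseteq> I" "card J = 4"
    using exists_subset_between[of "{i\<in>I. l i \<noteq> 0}" 4 I] I by auto
  have ball_J: "\<And>i. i \<in> J \<Longrightarrow> N (w i) \<le> 1" using ball J(2) by blast
  have "sum l J = sum l I" "(\<Sum>i\<in>J. l i *\<^sub>R w i) = (\<Sum>i\<in>I. l i *\<^sub>R w i)"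
    using J by (auto intro!: sum.mono_neutral_left[OF I(1)])
  then have "balanced_relation J w l" using l(1) J(2) by (auto simp: balanced_relation_def)
  then obtain S where "S \<subseteq> J" "card S = 3" "N (sum w S) \<le> 1"
    using triple_of_four_relation[OF dim N J(3), of w l] ball_J by blast
  then show ?thesis using that J(2) by blast
qed

section \<open>Descent to three vectors\<close>

text \<open>
  The index \<open>None\<close> carries the negated total. A triple through \<open>None\<close> sums to the negative of the
  sum over the remaining indices, which are all but two; this is how the removal of a pair arises.
\<close>

lemma triple_or_pair_removal_in_ball:
  fixes v :: "'i \<Rightarrow> 'a::euclidean_space"
  assumes dim: "DIM('a) = 2" and N: "is_norm N"
    and V: "finite V" "card V \<ge> 3" and ball: "\<And>i. i \<in> V \<Longrightarrow> N (v i) \<le> 1"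
    and total: "N (sum v V) \<le> 1"
  obtains S where "S \<subseteq> V" "card S = 3 \<or> card S = card V - 2" "N (sum v S) \<le> 1"
proof -
  define w where "w = case_option (- sum v V) v"
  let ?I = "insert None (Some ` V)"
  have sum_Some: "sum w (Some ` A) = sum v A" for A
    by (simp add: sum.reindex w_def)
  have "sum w ?I = 0" using V sum_Some[of V] by (simp add: w_def)
  have "finite ?I" using V by simp
  have "card ?I \<ge> 4" using V by (simp add: card_image)
  have "\<And>i. i \<in> ?I \<Longrightarrow> N (w i) \<le> 1"
    using ball total by (auto simp: w_def is_norm_minus[OF N])
  then obtain S where S: "S \<subseteq> ?I" "card S = 3" "N (sum w S) \<le> 1"
    by (rule triple_in_ball_of_zero_sum[OF dim N \<open>finite ?I\<close> \<open>card ?I \<ge> 4\<close> _ \<open>sum w ?I = 0\<close>])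
  have fS: "finite S" using S(2) by (simp add: card_ge_0_finite)
  obtain A where A: "A \<subseteq> V" "S - {None} = Some ` A"
    using S(1) subset_imageE[of "S - {None}" Some V] by blast
  show ?thesis
  proof (cases "None \<in> S")
    case False
    then have "S = Some ` A" using A by simp
    then show ?thesis using that[OF A(1)] S sum_Some[of A] by (simp add: card_image)
  next
    case True
    then have S_eq: "S = insert None (Some ` A)" using A by blast
    have fA: "finite A" using A(1) V(1) finite_subset by blast
    have "card A = 2" using S(2) fA unfolding S_eq by (simp add: card_image)
    then have "card (V - A) = card V - 2" using A(1) fA by (simp add: card_Diff_subset)
    moreover have "sum w S = - sum v (V - A)"
      using fA sum_Some[of A] sum.subset_diff[OF A(1) V(1), of v] unfolding S_eq by (simp add: w_def)
    then have "N (sum v (V - A)) \<le> 1" using S(3) is_norm_minus[OF N] by metis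
    ultimately show ?thesis using that[of "V - A"] by auto
  qed
qed

text \<open>
  Parity is what makes the descent hit the size \<open>3\<close>: removing pairs from an odd set of at least
  five indices never skips from above \<open>3\<close> to below it.
\<close>

lemma triple_in_ball_of_odd_sum:
  fixes v :: "'i \<Rightarrow> 'a::euclidean_space"
  assumes dim: "DIM('a) = 2" and N: "is_norm N"
    and "finite V" "odd (card V)" "card V \<ge> 3" "\<And>i. i \<in> V \<Longrightarrow> N (v i) \<le> 1" "N (sum v V) \<le> 1"
  shows "\<exists>S\<subseteq>V. card S = 3 \<and> N (sum v S) \<le> 1"
  using assms(3-)
proof (induction "card V" arbitrary: V rule: less_induct)
  case less
  show ?case
  proof (cases "card V = 3")
    case True
    then show ?thesis using less.prems by blast
  next
    case False
    then have "card V \<ge> 5" using less.prems by presburger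
    obtain S where S: "S \<subseteq> V" "card S = 3 \<or> card S = card V - 2" "N (sum v S) \<le> 1"
      using triple_or_pair_removal_in_ball[OF dim N, of V v] less.prems by blast
    have "odd (card S)" "card S \<ge> 3" "card S < card V"
      using S(2) less.prems(2) \<open>card V \<ge> 5\<close> by auto
    moreover have "finite S" using S(1) less.prems(1) finite_subset by blast
    ultimately obtain T where "T \<subseteq> S" "card T = 3 \<and> N (sum v T) \<le> 1"
      using less.hyps[of S] less.prems(4) S by blast
    then show ?thesis using S(1) by blast
  qed
qed

theorem corollary1:
  fixes N :: "real ^ 2 \<Rightarrow> real" and v :: "nat \<Rightarrow> real ^ 2" and n k :: nat
  assumes "is_norm N"
    and "n \<ge> 5"
    and "\<forall>i\<in>{1..n}. v i \<in> unit_ball N"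
    and "k \<in> {1..n}" and "odd k" and "k > 3"
    and "\<forall>x\<in>m_sums n v 3. x \<notin> unit_ball N"
  shows "\<forall>x\<in>m_sums n v k. x \<notin> unit_ball N"
proof (intro ballI notI)
  fix x assume "x \<in> m_sums n v k" and x: "x \<in> unit_ball N"
  then obtain V where V: "V \<subseteq> {1..n}" "card V = k" "x = sum v V" by (auto simp: m_sums_def)
  have "finite V" using V(1) finite_subset by blast
  moreover have "odd (card V)" "card V \<ge> 3" using V(2) assms(5,6) by auto
  moreover have "N (v i) \<le> 1" if "i \<in> V" for i
    using assms(3) V(1) that by (auto simp: unit_ball_def)
  moreover have "N (sum v V) \<le> 1" using x V(3) by (simp add: unit_ball_def)
  moreover have "DIM(real ^ 2) = 2" by simp
  ultimately obtain S where S: "S \<subseteq> V" "card S = 3" "N (sum v S) \<le> 1"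
    using triple_in_ball_of_odd_sum[OF _ assms(1), of V v] by blast
  have "sum v S \<in> m_sums n v 3" using S(1,2) V(1) unfolding m_sums_def by blast
  then show False using assms(7) S(3) by (simp add: unit_ball_def)
qed

end
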